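(* Let $(R,\mathfrak m)$ be a local domain and let $\mathfrak a_\bullet=\{\mathfrak a_p\}_{p\ge1}$ and $\mathfrak b_\bullet=\{\mathfrak b_q\}_{q\ge1}$ be graded families of ideals in $R$. Fix a finite set of (divisorial) valuations $V=\{v_1,\dots,v_N\}$ of $\operatorname{Frac}(R)$ centered at $\mathfrak m$. Assume: (H1) for all $p,q\ge1$ one has the equivalence $$\mathfrak b_q\subseteq\overline{\mathfrak a_p}\quad\Longleftrightarrow\quad v_i(\mathfrak b_q)\ge v_i(\mathfrak a_p)\ \text{ for all }1\le i\le N;$$ (H2) $v_i(\mathfrak b_\bullet)>0$ for each $i$. Then $$\mathcal L_{\mathfrak b_\bullet}(\mathfrak a_\bullet)=\max_{1\le i\le N}\frac{v_i(\mathfrak a_\bullet)}{v_i(\mathfrak b_\bullet)}.$$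
   Context: Ideals are always proper. A graded family of ideals $\{\mathfrak a_p\}_{p\ge1}$ satisfies $\mathfrak a_p\mathfrak a_{p'}\subseteq\mathfrak a_{p+p'}$ for all $p,p'\ge1$. Algebraic Łojasiewicz exponent: $\mathcal L_{\mathfrak b_\bullet}(\mathfrak a_\bullet):=\inf\{\frac qp\in\mathbb Q_{>0}:\ \mathfrak b_{qt}\subseteq\overline{\mathfrak a_{pt}}\text{ for all integers }t\gg1\}\in\mathbb R_{\ge0}\cup\{\infty\}$, with $\inf\emptyset=\infty$, where $\overline I$ is the integral closure of $I$. A valuation on $R$ is a map $v:R\setminus\{0\}\to\mathbb R_{\ge0}$ with $v(xy)=v(x)+v(y)$ and $v(x+y)\ge\min\{v(x),v(y)\}$, extended by $v(0)=\infty$ (and to $\operatorname{Frac}(R)$); it is centered at $\mathfrak m$ if $v(x)>0$ for all $x\in\mathfrak m$. For an ideal $I$, $v(I):=\min\{v(x):x\in I\}$. For a graded family, $v(\mathfrak a_\bullet):=\lim_{p\to\infty}\frac{v(\mathfrak a_p)}p=\inf_{p\ge1}\frac{v(\mathfrak a_p)}p$. *)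

theory Defs
  imports "HOL-Algebra.Ideal_Product" "HOL-Library.Extended_Real"
begin

definition local_domain :: "('a, 'b) ring_scheme \<Rightarrow> 'a set \<Rightarrow> bool" where
  "local_domain R \<mm> \<longleftrightarrow>
     domain R \<and> maximalideal \<mm> R \<and> (\<forall>\<nn>. maximalideal \<nn> R \<longrightarrow> \<nn> = \<mm>)"

text \<open>Families are functions on \<open>nat\<close> of which only the values at positive indices matter.\<close>

definition graded_family :: "('a, 'b) ring_scheme \<Rightarrow> (nat \<Rightarrow> 'a set) \<Rightarrow> bool" where
  "graded_family R \<aa> \<longleftrightarrow>
     (\<forall>p\<ge>1. ideal (\<aa> p) R \<and> \<aa> p \<noteq> carrier R) \<and>
     (\<forall>p\<ge>1. \<forall>p'\<ge>1. \<aa> p \<cdot>\<^bsub>R\<^esub> \<aa> p' \<subseteq> \<aa> (p + p'))"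

text \<open>The elements \<open>x\<close> satisfying an equation
  \<open>x\<^sup>n + c\<^sub>1 x\<^sup>n\<^sup>-\<^sup>1 + \<dots> + c\<^sub>n = 0\<close> with \<open>n \<ge> 1\<close> and \<open>c\<^sub>i \<in> I\<^sup>i\<close>; the power \<open>I\<^sup>i\<close> is taken in the
  multiplicative monoid of ideals of \<open>R\<close>.\<close>

definition ideal_integral_closure :: "('a, 'b) ring_scheme \<Rightarrow> 'a set \<Rightarrow> 'a set" where
  "ideal_integral_closure R I =
     {x \<in> carrier R. \<exists>n\<ge>(1::nat). \<exists>c. (\<forall>i\<in>{1..n}. c i \<in> I [^]\<^bsub>ideals_set R\<^esub> i) \<and>
        x [^]\<^bsub>R\<^esub> n \<oplus>\<^bsub>R\<^esub> (\<Oplus>\<^bsub>R\<^esub>i\<in>{1..n}. c i \<otimes>\<^bsub>R\<^esub> x [^]\<^bsub>R\<^esub> (n - i)) = \<zero>\<^bsub>R\<^esub>}"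

text \<open>The infimum is over pairs of positive integers; the infimum of the empty set of
  extended reals is \<open>\<infinity>\<close>.\<close>

definition lojasiewicz_exponent ::
    "('a, 'b) ring_scheme \<Rightarrow> (nat \<Rightarrow> 'a set) \<Rightarrow> (nat \<Rightarrow> 'a set) \<Rightarrow> ereal" where
  "lojasiewicz_exponent R \<bb> \<aa> =
     Inf {ereal (real q / real p) | p q. p \<ge> 1 \<and> q \<ge> 1 \<and>
            (\<forall>\<^sub>F t in sequentially. \<bb> (q * t) \<subseteq> ideal_integral_closure R (\<aa> (p * t)))}"

definition valuation_on :: "('a, 'b) ring_scheme \<Rightarrow> ('a \<Rightarrow> ereal) \<Rightarrow> bool" where
  "valuation_on R v \<longleftrightarrow>
     v \<zero>\<^bsub>R\<^esub> = \<infinity> \<and>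
     (\<forall>x\<in>carrier R - {\<zero>\<^bsub>R\<^esub>}. 0 \<le> v x \<and> v x < \<infinity>) \<and>
     (\<forall>x\<in>carrier R. \<forall>y\<in>carrier R.
        v (x \<otimes>\<^bsub>R\<^esub> y) = v x + v y \<and> v (x \<oplus>\<^bsub>R\<^esub> y) \<ge> min (v x) (v y))"

definition centered_at :: "'a set \<Rightarrow> ('a \<Rightarrow> ereal) \<Rightarrow> bool" where
  "centered_at \<mm> v \<longleftrightarrow> (\<forall>x\<in>\<mm>. v x > 0)"

text \<open>Written as an infimum, which is always defined. It is a minimum whenever \<open>I\<close> is
  finitely generated (\<open>val_ideal_attained\<close>), so for every ideal of a Noetherian ring, and also
  whenever the values of \<open>v\<close> are discrete.\<close>

definition val_ideal :: "('a \<Rightarrow> ereal) \<Rightarrow> 'a set \<Rightarrow> ereal" where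
  "val_ideal v I = (INF x\<in>I. v x)"

text \<open>The infimum is also the limit of the same quotients when no member of the
  family is zero (\<open>val_family_tendsto\<close>). Zero members have value \<open>\<infinity>\<close> and are allowed; note
  that \<open>\<infinity> / \<infinity> = 0\<close> in \<open>ereal\<close>.\<close>

definition val_family :: "('a \<Rightarrow> ereal) \<Rightarrow> (nat \<Rightarrow> 'a set) \<Rightarrow> ereal" where
  "val_family v \<aa> = (INF p\<in>{1..}. val_ideal v (\<aa> p) / ereal (real p))"

lemma val_ideal_attained:
  assumes R: "cring R" and v: "valuation_on R v"
    and S: "finite S" "S \<subseteq> carrier R" "S \<noteq> {}"
  shows "\<exists>x\<in>genideal R S. v x = val_ideal v (genideal R S)"
proof -
  interpret cring R by fact
  have vnn: "0 \<le> v x" if "x \<in> carrier R" for x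
    using v that unfolding valuation_on_def by (cases "x = \<zero>\<^bsub>R\<^esub>") auto
  have vmul: "v (x \<otimes>\<^bsub>R\<^esub> y) = v x + v y" and vadd: "v (x \<oplus>\<^bsub>R\<^esub> y) \<ge> min (v x) (v y)"
    if "x \<in> carrier R" "y \<in> carrier R" for x y
    using v that unfolding valuation_on_def by auto
  obtain s where s: "s \<in> S" "\<And>y. y \<in> S \<Longrightarrow> v s \<le> v y"
    using arg_min_if_finite[OF S(1,3), of v] by (metis not_le)
  define J where "J = {x \<in> carrier R. v s \<le> v x}"
  have mulJ: "r \<otimes>\<^bsub>R\<^esub> x \<in> J" if "x \<in> J" "r \<in> carrier R" for x r
    using that vmul[of r x] vnn[of r] add_mono[of 0 "v r" "v s" "v x"] unfolding J_def by auto
  have "ideal J R"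
  proof (rule idealI)
    show "subgroup J (add_monoid R)"
    proof (rule add.subgroupI)
      show "J \<subseteq> carrier R" unfolding J_def by auto
      show "J \<noteq> {}" using s S unfolding J_def by auto
      show "\<ominus>\<^bsub>R\<^esub> x \<in> J" if "x \<in> J" for x
        using mulJ[OF that, of "\<ominus>\<^bsub>R\<^esub> \<one>\<^bsub>R\<^esub>"] that by (simp add: J_def l_minus)
      show "x \<oplus>\<^bsub>R\<^esub> y \<in> J" if "x \<in> J" "y \<in> J" for x y
        using that vadd[of x y] unfolding J_def by (auto simp: min_def split: if_splits)
    qed
  next
    show "x \<otimes>\<^bsub>R\<^esub> a \<in> J" if "a \<in> J" "x \<in> carrier R" for a x using mulJ that by simp
    show "a \<otimes>\<^bsub>R\<^esub> x \<in> J" if "a \<in> J" "x \<in> carrier R" for a x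
      using mulJ[OF that] that m_comm[of a x] unfolding J_def by simp
  qed (rule ring_axioms)
  moreover have "S \<subseteq> J" using s S unfolding J_def by auto
  ultimately have "genideal R S \<subseteq> J" by (rule genideal_minimal)
  then have "v s \<le> val_ideal v (genideal R S)"
    unfolding val_ideal_def J_def by (auto intro!: INF_greatest)
  moreover have mem: "s \<in> genideal R S" using genideal_self[OF S(2)] s by auto
  then have "val_ideal v (genideal R S) \<le> v s" unfolding val_ideal_def by (rule INF_lower)
  ultimately show ?thesis using mem by (metis antisym)
qed

lemma val_ideal_nonneg:
  assumes "valuation_on R v" "I \<subseteq> carrier R"
  shows "0 \<le> val_ideal v I"
proof -
  have "0 \<le> v x" if "x \<in> I" for x
    using assms that unfolding valuation_on_def by (cases "x = \<zero>\<^bsub>R\<^esub>") auto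
  then show ?thesis unfolding val_ideal_def by (auto intro!: INF_greatest)
qed

lemma val_ideal_subadditive:
  assumes v: "valuation_on R v" and \<aa>: "graded_family R \<aa>" and pq: "p \<ge> 1" "q \<ge> 1"
  shows "val_ideal v (\<aa> (p + q)) \<le> val_ideal v (\<aa> p) + val_ideal v (\<aa> q)"
proof -
  have id: "ideal (\<aa> k) R" if "k \<ge> 1" for k using \<aa> that unfolding graded_family_def by auto
  have sub: "\<aa> k \<subseteq> carrier R" if "k \<ge> 1" for k
    using ideal.Icarr[OF id[OF that]] by auto
  have ne: "\<aa> k \<noteq> {}" if "k \<ge> 1" for k
    using additive_subgroup.zero_closed[OF ideal.axioms(1)[OF id[OF that]]] by auto
  have nn: "0 \<le> v x" if "x \<in> \<aa> k" "k \<ge> 1" for x k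
    using v that sub[of k] unfolding valuation_on_def by (cases "x = \<zero>\<^bsub>R\<^esub>") auto
  have le: "val_ideal v (\<aa> (p + q)) \<le> v x + v y" if "x \<in> \<aa> p" "y \<in> \<aa> q" for x y
  proof -
    have "x \<otimes>\<^bsub>R\<^esub> y \<in> \<aa> (p + q)"
      using \<aa> pq ideal_prod.prod[OF that, of R] unfolding graded_family_def by blast
    then have "val_ideal v (\<aa> (p + q)) \<le> v (x \<otimes>\<^bsub>R\<^esub> y)"
      unfolding val_ideal_def by (rule INF_lower)
    also have "\<dots> = v x + v y"
      using v that sub pq unfolding valuation_on_def by blast
    finally show ?thesis .
  qed
  have "val_ideal v (\<aa> (p + q)) \<le> v x + val_ideal v (\<aa> q)" if x: "x \<in> \<aa> p" for x
  proof -
    have "v x + val_ideal v (\<aa> q) = (INF y\<in>\<aa> q. v x + v y)"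
      unfolding val_ideal_def
      by (subst INF_ereal_add_right) (use ne[OF pq(2)] nn x pq in auto)
    then show ?thesis using le[OF x] by (auto intro!: INF_greatest)
  qed
  moreover have "val_ideal v (\<aa> p) + val_ideal v (\<aa> q) = (INF x\<in>\<aa> p. v x + val_ideal v (\<aa> q))"
    unfolding val_ideal_def[of v "\<aa> p"]
    by (subst INF_ereal_add_left)
       (use ne[OF pq(1)] nn pq val_ideal_nonneg[OF v sub[OF pq(2)]] in auto)
  ultimately show ?thesis by (auto intro!: INF_greatest)
qed

text \<open>Fekete's lemma.\<close>

lemma subadditive_tendsto_INF:
  fixes f :: "nat \<Rightarrow> real"
  assumes sub: "\<And>p q. p \<ge> 1 \<Longrightarrow> q \<ge> 1 \<Longrightarrow> f (p + q) \<le> f p + f q"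
  shows "(\<lambda>n. ereal (f n / real n)) \<longlonglongrightarrow> (INF p\<in>{1..}. ereal (f p / real p))"
proof (rule order_tendstoI)
  fix c assume "c < (INF p\<in>{1..}. ereal (f p / real p))"
  then have "c < ereal (f n / real n)" if "n \<ge> 1" for n
    using that by (meson INF_lower atLeast_iff less_le_trans)
  then show "\<forall>\<^sub>F n in sequentially. c < ereal (f n / real n)"
    unfolding eventually_sequentially by blast
next
  fix c assume "(INF p\<in>{1..}. ereal (f p / real p)) < c"
  then obtain k where k: "k \<ge> 1" "ereal (f k / real k) < c" by (auto simp: INF_less_iff)
  then obtain d where d: "ereal (f k / real k) < ereal d" "ereal d < c"
    using ereal_dense2 by metis
  define M where "M = Max ((\<lambda>r. \<bar>f r\<bar> + \<bar>f k\<bar>) ` {1..k})"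
  have mult: "f (k * m + r) \<le> real m * f k + f r" if "r \<ge> 1" for m r
  proof (induction m)
    case (Suc m)
    have "f (k + (k * m + r)) \<le> f k + f (k * m + r)" using sub k that by simp
    then show ?case using Suc by (simp add: algebra_simps)
  qed simp
  have bound: "f n / real n \<le> f k / real k + M / real n" if n: "n \<ge> 1" for n
  proof -
    define m where "m = (n - 1) div k"
    define r where "r = (n - 1) mod k + 1"
    have nmr: "n = k * m + r" using n unfolding m_def r_def by simp
    have r: "r \<ge> 1" "r \<le> k" using k unfolding r_def by (auto simp: Suc_le_eq)
    have "\<bar>f r\<bar> + \<bar>f k\<bar> \<le> M" unfolding M_def using r by (intro Max_ge) auto
    moreover have "real m * f k = (real n - real r) * (f k / real k)"
      using nmr k by (simp add: field_simps)
    moreover have "- (real r * (f k / real k)) \<le> \<bar>f k\<bar>"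
    proof -
      have "real r * \<bar>f k\<bar> \<le> real k * \<bar>f k\<bar>" using r by (intro mult_right_mono) auto
      then have "\<bar>real r * (f k / real k)\<bar> \<le> \<bar>f k\<bar>"
        using k by (simp add: abs_mult field_simps)
      then show ?thesis by linarith
    qed
    moreover have "f n \<le> real m * f k + f r" using mult[OF r(1), of m] nmr by simp
    moreover have "(real n - real r) * (f k / real k) =
        real n * (f k / real k) - real r * (f k / real k)" by (rule left_diff_distrib)
    ultimately have "f n \<le> real n * (f k / real k) + M" by linarith
    then show ?thesis using n by (simp add: field_simps)
  qed
  have "(\<lambda>n. f k / real k + M / real n) \<longlonglongrightarrow> f k / real k + 0"
    by (intro tendsto_intros lim_const_over_n)
  then have "\<forall>\<^sub>F n in sequentially. f k / real k + M / real n < d"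
    using d(1) by (intro order_tendstoD(2)) auto
  then have "\<forall>\<^sub>F n in sequentially. f n / real n < d"
    using eventually_ge_at_top[of 1]
    by eventually_elim (use bound in \<open>meson le_less_trans\<close>)
  then show "\<forall>\<^sub>F n in sequentially. ereal (f n / real n) < c"
    by eventually_elim (use d(2) in \<open>meson less_ereal.simps(1) less_trans\<close>)
qed

lemma val_family_tendsto:
  assumes v: "valuation_on R v" and \<aa>: "graded_family R \<aa>"
    and nonzero: "\<And>p. p \<ge> 1 \<Longrightarrow> \<aa> p \<noteq> {\<zero>\<^bsub>R\<^esub>}"
  shows "(\<lambda>p. val_ideal v (\<aa> p) / ereal (real p)) \<longlonglongrightarrow> val_family v \<aa>"
proof -
  define f where "f p = real_of_ereal (val_ideal v (\<aa> p))" for p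
  have f: "val_ideal v (\<aa> p) = ereal (f p)" if p: "p \<ge> 1" for p
  proof -
    have id: "ideal (\<aa> p) R" using \<aa> p unfolding graded_family_def by auto
    have sub: "\<aa> p \<subseteq> carrier R" using ideal.Icarr[OF id] by auto
    have "\<zero>\<^bsub>R\<^esub> \<in> \<aa> p"
      using additive_subgroup.zero_closed[OF ideal.axioms(1)[OF id]] .
    then obtain x where x: "x \<in> \<aa> p" "x \<noteq> \<zero>\<^bsub>R\<^esub>" using nonzero[OF p] by auto
    have "val_ideal v (\<aa> p) \<le> v x" unfolding val_ideal_def using x(1) by (rule INF_lower)
    also have "v x < \<infinity>" using v x sub unfolding valuation_on_def by auto
    finally show ?thesis using val_ideal_nonneg[OF v sub] unfolding f_def
      by (cases "val_ideal v (\<aa> p)") auto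
  qed
  have "(\<lambda>p. ereal (f p / real p)) \<longlonglongrightarrow> (INF p\<in>{1..}. ereal (f p / real p))"
  proof (rule subadditive_tendsto_INF)
    fix p q :: nat assume pq: "p \<ge> 1" "q \<ge> 1"
    show "f (p + q) \<le> f p + f q"
      using val_ideal_subadditive[OF v \<aa> pq] pq by (simp add: f)
  qed
  moreover have eq: "val_ideal v (\<aa> p) / ereal (real p) = ereal (f p / real p)" if "p \<ge> 1" for p
    using f[OF that] that by simp
  then have "val_family v \<aa> = (INF p\<in>{1..}. ereal (f p / real p))"
    unfolding val_family_def by (intro INF_cong) auto
  moreover have "\<forall>\<^sub>F p in sequentially.
      ereal (f p / real p) = val_ideal v (\<aa> p) / ereal (real p)"
    using eventually_ge_at_top[of 1] by eventually_elim (simp add: eq)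
  ultimately show ?thesis using Lim_transform_eventually by auto
qed

end

(* For a graded family c, subadditivity gives v(c_{km}) <= m v(c_k).  Hence whenever
   v(c_bullet) < s, some k satisfies v(c_{km}) <= k m s for all m >= 1; along multiples of k this
   replaces the limit defining v(c_bullet), which may fail to exist when some members are zero.

   If b_{qt} lies in the integral closure of a_{pt} for all large t, testing on multiples t of such
   a k for b gives p v_i(a_bullet) <= q v_i(b_bullet).  Conversely, if q/p exceeds every quotient
   v_i(a_bullet) / v_i(b_bullet), then s = (q/p) v_i(b_bullet) yields a k_i for a, and with K the
   product of the k_i one gets v_i(a_{pKt}) <= qKt v_i(b_bullet) <= v_i(b_{qKt}) for all t >= 1. *)

theory Submission
  imports Defs
begin

lemma val_family_nonneg:
  assumes "valuation_on R v" "graded_family R \<aa>"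
  shows "0 \<le> val_family v \<aa>"
proof -
  have "0 \<le> val_ideal v (\<aa> p) / ereal (real p)" if "p \<ge> 1" for p
  proof -
    have "ideal (\<aa> p) R"
      using assms(2) that unfolding graded_family_def by blast
    then have "\<aa> p \<subseteq> carrier R" by (meson ideal.Icarr subsetI)
    then show ?thesis
      using val_ideal_nonneg[OF assms(1)] that by simp
  qed
  then show ?thesis unfolding val_family_def by (auto intro!: INF_greatest)
qed

lemma val_family_mult_le_val_ideal:
  assumes "p \<ge> 1"
  shows "ereal (real p) * val_family v \<aa> \<le> val_ideal v (\<aa> p)"
proof -
  have "val_family v \<aa> \<le> val_ideal v (\<aa> p) / ereal (real p)"
    unfolding val_family_def using assms by (intro INF_lower) auto
  then show ?thesis using assms by (subst (asm) ereal_le_divide_pos) auto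
qed

lemma val_ideal_multiple_le:
  assumes v: "valuation_on R v" and \<aa>: "graded_family R \<aa>" and k: "k \<ge> 1" and m: "m \<ge> 1"
  shows "val_ideal v (\<aa> (k * m)) \<le> ereal (real m) * val_ideal v (\<aa> k)"
  using m
proof (induction m rule: nat_induct_at_least)
  case base
  then show ?case by (simp flip: one_ereal_def)
next
  case (Suc m)
  have "val_ideal v (\<aa> (k * m + k)) \<le> val_ideal v (\<aa> (k * m)) + val_ideal v (\<aa> k)"
    using val_ideal_subadditive[OF v \<aa>, of "k * m" k] k Suc.hyps by simp
  also have "\<dots> \<le> ereal (real m) * val_ideal v (\<aa> k) + val_ideal v (\<aa> k)"
    by (rule add_right_mono[OF Suc.IH])
  also have "\<dots> = ereal (real (Suc m)) * val_ideal v (\<aa> k)"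
    using ereal_left_distrib[of "ereal (real m)" 1 "val_ideal v (\<aa> k)"]
    by (simp add: one_ereal_def add.commute)
  finally show ?case by (simp add: add.commute)
qed

text \<open>Being an infimum, \<open>val_family\<close> is undercut by \<open>s\<close> at a single
  index \<open>k\<close>, and \<open>val_ideal_multiple_le\<close> carries the bound to all
  multiples of \<open>k\<close>. Nothing is claimed between them, where members may be zero and have
  value \<open>\<infinity>\<close>.\<close>

lemma val_family_less_imp_val_ideal_le:
  assumes v: "valuation_on R v" and \<aa>: "graded_family R \<aa>" and less: "val_family v \<aa> < s"
  obtains k where "k \<ge> 1"
    "\<And>m. m \<ge> 1 \<Longrightarrow> val_ideal v (\<aa> (k * m)) \<le> ereal (real (k * m)) * s"
proof -
  obtain k where k: "k \<ge> 1" "val_ideal v (\<aa> k) / ereal (real k) < s"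
    using less unfolding val_family_def by (auto simp: INF_less_iff)
  have le: "val_ideal v (\<aa> k) \<le> ereal (real k) * s"
    using k by (subst (asm) ereal_divide_less_pos) auto
  have "val_ideal v (\<aa> (k * m)) \<le> ereal (real (k * m)) * s" if "m \<ge> 1" for m
  proof -
    have "val_ideal v (\<aa> (k * m)) \<le> ereal (real m) * val_ideal v (\<aa> k)"
      by (rule val_ideal_multiple_le[OF v \<aa> k(1) that])
    also have "\<dots> \<le> ereal (real m) * (ereal (real k) * s)"
      by (rule ereal_mult_left_mono[OF le]) simp
    also have "\<dots> = ereal (real (k * m)) * s"
      by (simp add: mult.assoc[symmetric] mult.commute[of "real m"])
    finally show ?thesis .
  qed
  then show ?thesis using that k(1) by blast
qed

text \<open>One well chosen \<open>t\<close> suffices for each \<open>s\<close>: the lower bound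
  \<open>p * t * val_family v \<aa>\<close> holds at every index, so only the upper bound for
  \<open>\<bb>\<close> restricts \<open>t\<close>.\<close>

lemma val_family_quotient_le:
  assumes v: "valuation_on R v" and \<aa>: "graded_family R \<aa>" and \<bb>: "graded_family R \<bb>"
    and pos: "val_family v \<bb> > 0" and p: "p \<ge> 1" and q: "q \<ge> 1"
    and ev: "\<forall>\<^sub>F t in sequentially. val_ideal v (\<aa> (p * t)) \<le> val_ideal v (\<bb> (q * t))"
  shows "val_family v \<aa> / val_family v \<bb> \<le> ereal (real q / real p)"
proof (cases "val_family v \<bb> = \<infinity>")
  \<comment> \<open>Division by \<open>\<infinity>\<close> gives 0 in \<open>ereal\<close>, even for
    numerator \<open>\<infinity>\<close>.\<close>
  case True
  then show ?thesis by simp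
next
  case False
  obtain t0 where t0: "\<And>t. t \<ge> t0 \<Longrightarrow> val_ideal v (\<aa> (p * t)) \<le> val_ideal v (\<bb> (q * t))"
    using ev unfolding eventually_sequentially by blast
  \<comment> \<open>The ratio is kept on the left so that the right side is a bare \<open>s\<close>,
    which density then lowers to \<open>val_family v \<bb>\<close>.\<close>
  have "val_family v \<aa> / ereal (real q / real p) \<le> s" if s: "val_family v \<bb> < s" for s
  proof -
    obtain k where k: "k \<ge> 1"
      "\<And>m. m \<ge> 1 \<Longrightarrow> val_ideal v (\<bb> (k * m)) \<le> ereal (real (k * m)) * s"
      using val_family_less_imp_val_ideal_le[OF v \<bb> s] by blast
    \<comment> \<open>The factor \<open>k\<close> makes \<open>q * t\<close> a multiple of
      \<open>k\<close>; \<open>Suc\<close> keeps \<open>t\<close> positive when \<open>t0\<close> is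
      0.\<close>
    define t where "t = k * Suc t0"
    have t: "t \<ge> 1" "t \<ge> t0"
      using k(1) mult_le_mono1[of 1 k "Suc t0"] unfolding t_def by auto
    have "ereal (real (p * t)) * val_family v \<aa> \<le> val_ideal v (\<aa> (p * t))"
      using p t by (intro val_family_mult_le_val_ideal) simp
    also have "\<dots> \<le> val_ideal v (\<bb> (q * t))" by (rule t0[OF t(2)])
    also have "\<dots> = val_ideal v (\<bb> (k * (q * Suc t0)))" by (simp only: t_def mult_ac)
    also have "\<dots> \<le> ereal (real (k * (q * Suc t0))) * s" using q by (intro k(2)) simp
    also have "\<dots> = ereal (real (q * t)) * s" by (simp only: t_def mult_ac)
    finally have "ereal (real (p * t)) * val_family v \<aa> \<le> ereal (real (q * t)) * s" .
    \<comment> \<open>If \<open>val_family v \<aa>\<close> is infinite, the inequality just obtained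
      forces \<open>s\<close> to be infinite too.\<close>
    then show ?thesis
      using p q t val_family_nonneg[OF v \<aa>] pos s
      by (cases "val_family v \<aa>"; cases s) (auto simp: field_simps)
  qed
  then have "val_family v \<aa> / ereal (real q / real p) \<le> val_family v \<bb>"
    by (rule dense_ge)
  then show ?thesis
    using p q pos False val_family_nonneg[OF v \<aa>]
    by (cases "val_family v \<aa>"; cases "val_family v \<bb>") (auto simp: field_simps)
qed

text \<open>A partial converse of \<open>val_family_quotient_le\<close>: strictness leaves room for
  an index that is good for \<open>\<aa>\<close>, while \<open>val_family v \<bb>\<close> bounds
  every term of \<open>\<bb>\<close> from below. The resulting \<open>k\<close> depends on
  \<open>v\<close>.\<close>

lemma val_ideal_le_of_quotient_less:
  assumes v: "valuation_on R v" and \<aa>: "graded_family R \<aa>"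
    and pos: "val_family v \<bb> > 0" and p: "p \<ge> 1" and q: "q \<ge> 1"
    and less: "val_family v \<aa> / val_family v \<bb> < ereal (real q / real p)"
  shows "\<exists>k\<ge>1. \<forall>t\<ge>1. val_ideal v (\<aa> (p * (k * t))) \<le> val_ideal v (\<bb> (q * (k * t)))"
proof (cases "val_family v \<bb> = \<infinity>")
  case True
  \<comment> \<open>An infinite infimum makes every term infinite, so the comparison is trivial and
    \<open>k = 1\<close> works.\<close>
  have "val_ideal v (\<bb> (q * t)) = \<infinity>" if "t \<ge> 1" for t
    using val_family_mult_le_val_ideal[of "q * t" v \<bb>] True q that by (simp split: if_splits)
  then show ?thesis by (intro exI[of _ 1]) simp
next
  case False
  define s where "s = ereal (real q / real p) * val_family v \<bb>"
  have "val_family v \<aa> < s"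
    unfolding s_def using less pos False p q val_family_nonneg[OF v \<aa>]
    by (cases "val_family v \<aa>"; cases "val_family v \<bb>") (auto simp: field_simps)
  then obtain k where k: "k \<ge> 1"
    "\<And>m. m \<ge> 1 \<Longrightarrow> val_ideal v (\<aa> (k * m)) \<le> ereal (real (k * m)) * s"
    using val_family_less_imp_val_ideal_le[OF v \<aa>] by blast
  have "val_ideal v (\<aa> (p * (k * t))) \<le> val_ideal v (\<bb> (q * (k * t)))" if t: "t \<ge> 1" for t
  proof -
    have "val_ideal v (\<aa> (p * (k * t))) = val_ideal v (\<aa> (k * (p * t)))"
      by (simp only: mult_ac)
    also have "\<dots> \<le> ereal (real (k * (p * t))) * s" using p t by (intro k(2)) simp
    \<comment> \<open>The factor \<open>p\<close> in the index cancels the denominator in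
      \<open>s\<close>.\<close>
    also have "\<dots> = ereal (real (q * (k * t))) * val_family v \<bb>"
      unfolding s_def using p by (simp add: mult.assoc[symmetric]) (simp add: mult_ac)
    also have "\<dots> \<le> val_ideal v (\<bb> (q * (k * t)))"
      using q k t by (intro val_family_mult_le_val_ideal) simp
    finally show ?thesis .
  qed
  with k(1) show ?thesis by blast
qed

text \<open>Supplies candidates in the form over which the exponent takes its infimum;
  \<open>0 \<le> x\<close> forces the rational, hence its numerator, to be positive.\<close>

lemma ereal_dense_pos_rat:
  assumes "0 \<le> x" "x < (y :: ereal)"
  obtains p q :: nat where "p \<ge> 1" "q \<ge> 1" "x < ereal (real q / real p)" "ereal (real q / real p) < y"
proof -
  obtain r where r: "x < ereal (real_of_rat r)" "ereal (real_of_rat r) < y"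
    using ereal_dense3[OF assms(2)] by auto
  have "0 < ereal (real_of_rat r)" using assms(1) r(1) by (rule le_less_trans)
  then have "0 < r" by simp
  obtain m n where mn: "r = Fract m n" "n > 0" by (cases r) auto
  then have m: "m > 0" using \<open>0 < r\<close> by (simp add: zero_less_Fract_iff)
  have "real_of_rat r = real (nat m) / real (nat n)"
    using mn m by (simp add: of_rat_rat)
  moreover have "nat n \<ge> 1" "nat m \<ge> 1" using mn m by auto
  ultimately show ?thesis using that r by metis
qed

theorem theorem5p8:
  fixes R :: "('a, 'b) ring_scheme" and \<mm> :: "'a set"
    and \<aa> \<bb> :: "nat \<Rightarrow> 'a set"
    and N :: nat and v :: "nat \<Rightarrow> 'a \<Rightarrow> ereal"
  assumes "local_domain R \<mm>"
    and "graded_family R \<aa>" and "graded_family R \<bb>"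
    and "N \<ge> 1"
    and "\<And>i. i \<in> {1..N} \<Longrightarrow> valuation_on R (v i) \<and> centered_at \<mm> (v i)"
    and H1: "\<And>p q. p \<ge> 1 \<Longrightarrow> q \<ge> 1 \<Longrightarrow>
      \<bb> q \<subseteq> ideal_integral_closure R (\<aa> p) \<longleftrightarrow>
      (\<forall>i\<in>{1..N}. val_ideal (v i) (\<bb> q) \<ge> val_ideal (v i) (\<aa> p))"
    and H2: "\<And>i. i \<in> {1..N} \<Longrightarrow> val_family (v i) \<bb> > 0"
  shows "lojasiewicz_exponent R \<bb> \<aa> =
    (MAX i\<in>{1..N}. val_family (v i) \<aa> / val_family (v i) \<bb>)"
proof (rule antisym)
  let ?quot = "\<lambda>i. val_family (v i) \<aa> / val_family (v i) \<bb>"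
  note \<aa> = assms(2) and \<bb> = assms(3)
  have v: "valuation_on R (v i)" if "i \<in> {1..N}" for i using assms(5) that by blast
  have quot_le: "?quot i \<le> (MAX i\<in>{1..N}. ?quot i)" if "i \<in> {1..N}" for i
    using that by (intro Max_ge) auto
  show "lojasiewicz_exponent R \<bb> \<aa> \<le> (MAX i\<in>{1..N}. ?quot i)"
  \<comment> \<open>Passing to \<open>y\<close> above the maximum makes room for a ratio strictly
    above every quotient, as the choice of the \<open>k i\<close> requires.\<close>
  proof (rule dense_ge)
    fix y assume y: "(MAX i\<in>{1..N}. ?quot i) < y"
    have one: "1 \<in> {1..N}" using assms(4) by simp
    have "0 \<le> ?quot 1"
      using val_family_nonneg[OF v[OF one] \<aa>] val_family_nonneg[OF v[OF one] \<bb>]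
        H2[OF one] by (cases "val_family (v 1) \<bb> = \<infinity>") (auto intro: zero_le_divide_ereal)
    then have "0 \<le> (MAX i\<in>{1..N}. ?quot i)" using quot_le[OF one] by (rule order_trans)
    then obtain p q :: nat where pq: "p \<ge> 1" "q \<ge> 1"
      and less: "(MAX i\<in>{1..N}. ?quot i) < ereal (real q / real p)" "ereal (real q / real p) < y"
      using ereal_dense_pos_rat y by blast
    have "\<forall>i\<in>{1..N}. \<exists>k\<ge>1. \<forall>t\<ge>1.
        val_ideal (v i) (\<aa> (p * (k * t))) \<le> val_ideal (v i) (\<bb> (q * (k * t)))"
      using val_ideal_le_of_quotient_less[OF v \<aa> H2 pq] quot_le less(1) le_less_trans by blast
    then obtain k where k: "\<And>i. i \<in> {1..N} \<Longrightarrow> k i \<ge> 1" "\<And>i t. i \<in> {1..N} \<Longrightarrow> t \<ge> 1 \<Longrightarrow>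
        val_ideal (v i) (\<aa> (p * (k i * t))) \<le> val_ideal (v i) (\<bb> (q * (k i * t)))"
      by metis
    \<comment> \<open>A common multiple of the \<open>k i\<close> serves all valuations at once.
      Scaling \<open>p\<close> and \<open>q\<close> by \<open>K\<close> yields another admissible
      pair with the same ratio.\<close>
    define K where "K = (\<Prod>i\<in>{1..N}. k i)"
    have K: "K \<ge> 1" unfolding K_def using k(1) by (intro prod_ge_1) auto
    have "\<bb> (q * K * t) \<subseteq> ideal_integral_closure R (\<aa> (p * K * t))" if t: "t \<ge> 1" for t
    proof -
      have "val_ideal (v i) (\<aa> (p * K * t)) \<le> val_ideal (v i) (\<bb> (q * K * t))"
        if i: "i \<in> {1..N}" for i
      proof -
        obtain m where m: "K = k i * m"
          unfolding K_def using dvd_prodI[of "{1..N}" i k] i by auto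
        then have "m * t \<ge> 1" using K t by (cases m) auto
        from k(2)[OF i this] show ?thesis by (simp add: m mult_ac)
      qed
      moreover have "p * K * t \<ge> 1" "q * K * t \<ge> 1" using pq K t by auto
      ultimately show ?thesis using H1 by blast
    qed
    then have "\<forall>\<^sub>F t in sequentially. \<bb> (q * K * t) \<subseteq> ideal_integral_closure R (\<aa> (p * K * t))"
      unfolding eventually_sequentially by blast
    moreover have "p * K \<ge> 1" "q * K \<ge> 1" using pq K by auto
    ultimately have "lojasiewicz_exponent R \<bb> \<aa> \<le> ereal (real (q * K) / real (p * K))"
      unfolding lojasiewicz_exponent_def by (intro Inf_lower) blast
    also have "\<dots> = ereal (real q / real p)" using K by simp
    also have "\<dots> \<le> y" using less(2) by simp
    finally show "lojasiewicz_exponent R \<bb> \<aa> \<le> y" .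
  qed
  show "(MAX i\<in>{1..N}. ?quot i) \<le> lojasiewicz_exponent R \<bb> \<aa>"
    unfolding lojasiewicz_exponent_def
  proof (rule Inf_greatest, clarify)
    fix p q :: nat
    assume pq: "p \<ge> 1" "q \<ge> 1" and
      ev: "\<forall>\<^sub>F t in sequentially. \<bb> (q * t) \<subseteq> ideal_integral_closure R (\<aa> (p * t))"
    have "?quot i \<le> ereal (real q / real p)" if i: "i \<in> {1..N}" for i
    proof (rule val_family_quotient_le[OF v[OF i] \<aa> \<bb> H2[OF i] pq])
      show "\<forall>\<^sub>F t in sequentially. val_ideal (v i) (\<aa> (p * t)) \<le> val_ideal (v i) (\<bb> (q * t))"
        \<comment> \<open>\<open>H1\<close> speaks only of positive indices, so \<open>t = 0\<close>
          has to be excluded.\<close>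
        using ev eventually_ge_at_top[of 1]
      proof eventually_elim
        case (elim t)
        then have "p * t \<ge> 1" "q * t \<ge> 1" using pq by auto
        then show ?case using H1 elim(1) i by blast
      qed
    qed
    then show "(MAX i\<in>{1..N}. ?quot i) \<le> ereal (real q / real p)"
      using assms(4) by (intro Max.boundedI) auto
  qed
qed

end
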